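(* Let $n\ge 2$, let $(X,\|\cdot\|)$ be a normed linear space over $\mathbb{K}$ ($\mathbb{K}=\mathbb{R}$ or $\mathbb{C}$), $\mathbf{a}=(a_1,\dots,a_n)\in\mathbb{K}^n$, $\mathbf{p}=(p_1,\dots,p_n)\in\mathbb{R}^n$ and $\mathbf{x}=(x_1,\dots,x_n)\in X^n$. Then the following three inequalities hold: (i) $\displaystyle \|T_n(\mathbf{p};\mathbf{a},\mathbf{x})\|\le \max_{1\le i,j\le n-1}\left\{|P_{\min\{i,j\}}||\overline{P}_{\max\{i,j\}}|\right\}\cdot\sum_{i=1}^{n-1}|\Delta a_i|\sum_{i=1}^{n-1}\|\Delta x_i\|$; (ii) for all real $p>1$ and $q$ with $\frac1p+\frac1q=1$, $\displaystyle \|T_n(\mathbf{p};\mathbf{a},\mathbf{x})\|\le \Big(\sum_{i=1}^{n-1}\sum_{j=1}^{n-1}|P_{\min\{i,j\}}|^q|\overline{P}_{\max\{i,j\}}|^q\Big)^{1/q}\Big(\sum_{i=1}^{n-1}|\Delta a_i|^p\Big)^{1/p}\Big(\sum_{i=1}^{n-1}\|\Delta x_i\|^p\Big)^{1/p}$; (iii) $\displaystyle \|T_n(\mathbf{p};\mathbf{a},\mathbf{x})\|\le \sum_{i=1}^{n-1}\sum_{j=1}^{n-1}|P_{\min\{i,j\}}||\overline{P}_{\max\{i,j\}}|\cdot\max_{1\le i\le n-1}|\Delta a_i|\max_{1\le i\le n-1}\|\Delta x_i\|$. Moreover, each of these inequalities is sharp in the sense that the constant $1$ multiplying its right-hand side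 cannot be replaced by a smaller constant.
   Context: The Čebyšev functional is $T_n(\mathbf{p};\mathbf{a},\mathbf{x}):=P_n\sum_{i=1}^n p_ia_ix_i-\left(\sum_{i=1}^n p_ia_i\right)\cdot\sum_{i=1}^n p_ix_i$. Notation: $P_i:=\sum_{k=1}^i p_k$ for $1\le i\le n$; $\overline{P}_i:=P_n-P_i$, $\Delta a_i:=a_{i+1}-a_i$ and $\Delta x_i:=x_{i+1}-x_i$ for $1\le i\le n-1$. The bold $\mathbf{p}$ is the weight tuple; the exponent $p$ is unrelated to it. Sharpness of an inequality $\|T_n\|\le R$ (with $p,q$ fixed, in the case of (ii)) means: if $C>0$ is a constant such that $\|T_n\|\le C\,R$ for all $n\ge2$, all normed spaces $X$ and all admissible $\mathbf{p},\mathbf{a},\mathbf{x}$, then $C\ge1$. *)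

theory Defs
  imports Complex_Main
begin

text \<open>
  The scalar field \<open>\<real>\<close> or \<open>\<complex>\<close>.  The axiom forces a member of the class to be
  isometrically isomorphic to one of the two, since the only multiplicative
  norm on \<open>\<complex>\<close> extending the absolute value of \<open>\<real>\<close> is the usual modulus.
\<close>

class real_or_complex = real_normed_field +
  assumes real_or_complex:
    "(\<forall>z. \<exists>r. z = r *\<^sub>R 1) \<or>
     (\<exists>i. i * i = - 1 \<and> (\<forall>z. \<exists>r s. z = r *\<^sub>R 1 + s *\<^sub>R i))"

instance real :: real_or_complex
proof
  have "\<forall>z::real. \<exists>r. z = r *\<^sub>R 1" by simp
  then show "(\<forall>z::real. \<exists>r. z = r *\<^sub>R 1) \<or>
     (\<exists>i::real. i * i = - 1 \<and> (\<forall>z. \<exists>r s. z = r *\<^sub>R 1 + s *\<^sub>R i))" ..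
qed

instance complex :: real_or_complex
proof
  have "z = Re z *\<^sub>R 1 + Im z *\<^sub>R \<i>" for z
    by (simp add: complex_eq_iff)
  then have "\<i> * \<i> = - 1 \<and> (\<forall>z. \<exists>r s. z = r *\<^sub>R 1 + s *\<^sub>R \<i>)"
    by (metis i_squared)
  then show "(\<forall>z::complex. \<exists>r. z = r *\<^sub>R 1) \<or>
     (\<exists>i::complex. i * i = - 1 \<and> (\<forall>z. \<exists>r s. z = r *\<^sub>R 1 + s *\<^sub>R i))"
    by blast
qed

text \<open>
  The class \<open>real_normed_vector\<close> only covers real scalars, so scalar
  multiplication and norm are explicit parameters here.
\<close>

locale normed_space = vector_space scale
  for scale :: "'k::real_normed_field \<Rightarrow> 'x::ab_group_add \<Rightarrow> 'x" +
  fixes nrm :: "'x \<Rightarrow> real"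
  assumes nrm_eq_0_iff: "nrm x = 0 \<longleftrightarrow> x = 0"
    and nrm_triangle: "nrm (x + y) \<le> nrm x + nrm y"
    and nrm_scale: "nrm (scale c x) = norm c * nrm x"

lemma normed_space_scaleR:
  "normed_space scaleR (norm :: 'x::real_normed_vector \<Rightarrow> real)"
  by unfold_locales (auto simp: algebra_simps norm_triangle_ineq)

lemma normed_space_mult:
  "normed_space (*) (norm :: 'k::real_normed_field \<Rightarrow> real)"
  by unfold_locales (auto simp: algebra_simps norm_triangle_ineq norm_mult)

text \<open>
  An \<open>n\<close>-tuple is a function on \<open>nat\<close> of which only the values at \<open>1, \<dots>, n\<close> are used.
\<close>

definition weight_sum :: "(nat \<Rightarrow> real) \<Rightarrow> nat \<Rightarrow> real" where
  "weight_sum p i = (\<Sum>k=1..i. p k)"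

definition weight_tail :: "nat \<Rightarrow> (nat \<Rightarrow> real) \<Rightarrow> nat \<Rightarrow> real" where
  "weight_tail n p i = weight_sum p n - weight_sum p i"

definition diff :: "(nat \<Rightarrow> 'a::ab_group_add) \<Rightarrow> nat \<Rightarrow> 'a" where
  "diff u i = u (i + 1) - u i"

definition cebysev ::
    "('k::real_normed_field \<Rightarrow> 'x::ab_group_add \<Rightarrow> 'x) \<Rightarrow>
     nat \<Rightarrow> (nat \<Rightarrow> real) \<Rightarrow> (nat \<Rightarrow> 'k) \<Rightarrow> (nat \<Rightarrow> 'x) \<Rightarrow> 'x" where
  "cebysev scale n p a x =
     scale (of_real (weight_sum p n)) (\<Sum>i=1..n. scale (of_real (p i) * a i) (x i))
     - scale (\<Sum>i=1..n. of_real (p i) * a i) (\<Sum>i=1..n. scale (of_real (p i)) (x i))"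

definition kernel :: "nat \<Rightarrow> (nat \<Rightarrow> real) \<Rightarrow> nat \<Rightarrow> nat \<Rightarrow> real" where
  "kernel n p i j = \<bar>weight_sum p (min i j)\<bar> * \<bar>weight_tail n p (max i j)\<bar>"

type_synonym ('k, 'x) bound =
  "('x \<Rightarrow> real) \<Rightarrow> nat \<Rightarrow> (nat \<Rightarrow> real) \<Rightarrow> (nat \<Rightarrow> 'k) \<Rightarrow> (nat \<Rightarrow> 'x) \<Rightarrow> real"

definition max_bound :: "('k::real_normed_field, 'x::ab_group_add) bound" where
  "max_bound nrm n p a x =
     Max {kernel n p i j | i j. i \<in> {1..n-1} \<and> j \<in> {1..n-1}}
     * (\<Sum>i=1..n-1. norm (diff a i)) * (\<Sum>i=1..n-1. nrm (diff x i))"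

definition holder_bound ::
    "real \<Rightarrow> real \<Rightarrow> ('k::real_normed_field, 'x::ab_group_add) bound" where
  "holder_bound r s nrm n p a x =
     (\<Sum>i=1..n-1. \<Sum>j=1..n-1.
        \<bar>weight_sum p (min i j)\<bar> powr s * \<bar>weight_tail n p (max i j)\<bar> powr s) powr (1 / s)
     * (\<Sum>i=1..n-1. norm (diff a i) powr r) powr (1 / r)
     * (\<Sum>i=1..n-1. nrm (diff x i) powr r) powr (1 / r)"

definition sum_bound :: "('k::real_normed_field, 'x::ab_group_add) bound" where
  "sum_bound nrm n p a x =
     (\<Sum>i=1..n-1. \<Sum>j=1..n-1. kernel n p i j)
     * (MAX i\<in>{1..n-1}. norm (diff a i)) * (MAX i\<in>{1..n-1}. nrm (diff x i))"

text \<open>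
  Types cannot be quantified over, so the spaces occurring in the premise are the normed
  spaces over \<open>'k\<close> with underlying additive group \<open>'x\<close>.  Fewer spaces in the
  premise make sharpness a stronger property.
\<close>

definition sharp :: "('k::real_normed_field, 'x::ab_group_add) bound \<Rightarrow> bool" where
  "sharp R \<longleftrightarrow>
     (\<forall>C>0. (\<forall>n\<ge>2. \<forall>(scale :: 'k \<Rightarrow> 'x \<Rightarrow> 'x) nrm. normed_space scale nrm \<longrightarrow>
               (\<forall>p a x. nrm (cebysev scale n p a x) \<le> C * R nrm n p a x))
            \<longrightarrow> C \<ge> 1)"

end

theory Submission
  imports "HOL-Analysis.Convex" Defs
begin
text \<open>
  Everything rests on one identity, bilinear in the increments of the two tuples:
  \<open>T\<^sub>n(p; a, x)\<close> is the sum over \<open>1 \<le> i, j \<le> n - 1\<close> of the terms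
  \<open>P\<^bsub>min i j\<^esub> (P\<^sub>n - P\<^bsub>max i j\<^esub>) \<Delta>a\<^sub>i \<Delta>x\<^sub>j\<close>
  (\<open>cebysev_eq_sum_increments\<close>).  The functional is bilinear and does not change when a constant
  tuple is added to \<open>a\<close> or to \<open>x\<close>, so it must be a bilinear form in the increments; the
  coefficient is the value of the functional at two step tuples, one jumping from 0 to 1 after
  place \<open>i\<close>, the other after place \<open>j\<close>.

  The triangle inequality bounds the norm of this double sum by the sum of the products
  \<open>kernel n p i j * (norm (diff a i) * nrm (diff x j))\<close> (\<open>nrm_cebysev_le\<close>).  The three
  inequalities are Hoelder's inequality for this last sum, a pairing on the square of all
  \<open>(i, j)\<close>: the kernel is measured in the norms with exponent \<open>\<infinity>\<close>, \<open>s\<close> and \<open>1\<close>, the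
  increments in the norms with the conjugate exponent \<open>1\<close>, \<open>r\<close> and \<open>\<infinity>\<close>.  In each case the
  norm of the array of products of increments is the product of the norms of its two factors.

  For \<open>n = 2\<close> the square is a single point and nothing is lost in any of these steps.  With unit
  weights and \<open>a = x = (0, 1)\<close> over the scalar field itself, the functional and all three bounds
  are equal to \<open>1\<close>, so that no constant below \<open>1\<close> is possible (\<open>sharpI\<close>).
\<close>

section \<open>The functional as a bilinear form in the increments\<close>

lemma weight_sum_Suc: "weight_sum p (Suc n) = weight_sum p n + p (Suc n)"
  by (simp add: weight_sum_def)

lemma diff_telescope:
  "k \<le> Suc n \<Longrightarrow> (\<Sum>i=k..n. diff u i) = u (Suc n) - u k"
  unfolding diff_def Suc_eq_plus1[symmetric] by (rule sum_Suc_diff)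

lemma sum_indicator_tail:
  fixes f :: "nat \<Rightarrow> 'a::comm_monoid_add"
  assumes "1 \<le> k"
  shows "(\<Sum>i=1..n. if k \<le> i then f i else 0) = (\<Sum>i=k..n. f i)"
proof -
  have "{i \<in> {1..n}. k \<le> i} = {k..n}" using assms by auto
  then show ?thesis by (simp flip: sum.inter_filter)
qed

context normed_space
begin

text \<open>
  Write \<open>weight_sum p (min i j)\<close> as the sum of those \<open>p k\<close> with \<open>k \<le> i\<close> and \<open>k \<le> j\<close> and sum
  over \<open>k\<close> last: for fixed \<open>k\<close> the double sum is a product of two telescoping sums.
\<close>

lemma sum_weight_min_increments:
  "(\<Sum>i=1..n. \<Sum>j=1..n. scale (of_real (weight_sum p (min i j)) * diff a i) (diff x j))
     = (\<Sum>k=1..n. scale (of_real (p k) * (a (Suc n) - a k)) (x (Suc n) - x k))"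
    (is "?L = ?R")
proof -
  let ?s = "\<lambda>k i. if k \<le> i then diff a i else 0"
  let ?t = "\<lambda>k j. if k \<le> j then diff x j else 0"
  have W: "scale (of_real (weight_sum p (min i j)) * diff a i) (diff x j)
      = (\<Sum>k=1..n. scale (of_real (p k) * ?s k i) (?t k j))"
    if "i \<in> {1..n}" "j \<in> {1..n}" for i j
  proof -
    have "{k \<in> {1..n}. k \<le> min i j} = {1..min i j}" using that by auto
    then have "weight_sum p (min i j) = (\<Sum>k=1..n. if k \<le> min i j then p k else 0)"
      unfolding weight_sum_def by (simp flip: sum.inter_filter)
    then have "scale (of_real (weight_sum p (min i j)) * diff a i) (diff x j)
      = (\<Sum>k=1..n. scale (of_real (if k \<le> min i j then p k else 0) * diff a i) (diff x j))"
      by (simp only: of_real_sum sum_distrib_right scale_sum_left)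
    also have "\<dots> = (\<Sum>k=1..n. scale (of_real (p k) * ?s k i) (?t k j))"
      by (rule sum.cong) auto
    finally show ?thesis .
  qed
  have "?L = (\<Sum>i=1..n. \<Sum>j=1..n. \<Sum>k=1..n. scale (of_real (p k) * ?s k i) (?t k j))"
    using W by (intro sum.cong refl) blast
  also have "\<dots> = (\<Sum>i=1..n. \<Sum>k=1..n. \<Sum>j=1..n. scale (of_real (p k) * ?s k i) (?t k j))"
    by (intro sum.cong refl sum.swap)
  also have "\<dots> = (\<Sum>k=1..n. \<Sum>i=1..n. \<Sum>j=1..n. scale (of_real (p k) * ?s k i) (?t k j))"
    by (rule sum.swap)
  also have "\<dots> = (\<Sum>k=1..n. scale (of_real (p k) * (\<Sum>i=1..n. ?s k i)) (\<Sum>j=1..n. ?t k j))"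
    by (simp only: sum_distrib_left scale_sum_left, simp only: scale_sum_right)
  also have "\<dots> = ?R"
    by (intro sum.cong refl) (simp add: sum_indicator_tail diff_telescope del: One_nat_def)
  finally show ?thesis .
qed

text \<open>
  The recursion in the number of entries.  The terms of second order in the new weight cancel, and
  what remains is linear in it, with a coefficient that depends on differences to the new entries
  only, as the invariance under constants requires.
\<close>

lemma cebysev_Suc:
  "cebysev scale (Suc n) p a x = cebysev scale n p a x
     + scale (of_real (p (Suc n)))
         (\<Sum>k=1..n. scale (of_real (p k) * (a (Suc n) - a k)) (x (Suc n) - x k))"
proof -
  let ?W = "of_real (weight_sum p n) :: 'k"
  let ?A = "\<Sum>i=1..n. of_real (p i) * a i"
  let ?X = "\<Sum>i=1..n. scale (of_real (p i)) (x i)"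
  let ?AX = "\<Sum>i=1..n. scale (of_real (p i) * a i) (x i)"
  have "(\<Sum>k=1..n. scale (of_real (p k) * (a (Suc n) - a k)) (x (Suc n) - x k))
     = (\<Sum>k=1..n. scale (of_real (p k)) (scale (a (Suc n)) (x (Suc n)))
          - scale (a (Suc n)) (scale (of_real (p k)) (x k))
          - scale (of_real (p k) * a k) (x (Suc n)) + scale (of_real (p k) * a k) (x k))"
    by (intro sum.cong refl) (simp add: algebra_simps)
  also have "\<dots> = scale ?W (scale (a (Suc n)) (x (Suc n))) - scale (a (Suc n)) ?X
      - scale ?A (x (Suc n)) + ?AX"
    by (simp only: sum.distrib sum_subtractf weight_sum_def of_real_sum
        scale_sum_left scale_sum_right)
  finally have expand: "(\<Sum>k=1..n. scale (of_real (p k) * (a (Suc n) - a k)) (x (Suc n) - x k)) = \<dots>" .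
  show ?thesis
    unfolding expand by (simp add: cebysev_def weight_sum_Suc algebra_simps)
qed

text \<open>
  By induction on \<open>n\<close>: appending an entry adds \<open>p (Suc n)\<close> to every \<open>weight_tail\<close>, so the double
  sum grows by \<open>p (Suc n)\<close> times the form in \<open>sum_weight_min_increments\<close>, which is the growth of
  the functional in \<open>cebysev_Suc\<close>.
\<close>

lemma cebysev_eq_sum_increments:
  "cebysev scale n p a x = (\<Sum>i=1..<n. \<Sum>j=1..<n.
     scale (of_real (weight_sum p (min i j) * weight_tail n p (max i j)) * diff a i) (diff x j))"
proof (induction n)
  case 0
  then show ?case by (simp add: cebysev_def weight_sum_def)
next
  case (Suc n)
  let ?t = "\<lambda>c i j. scale (of_real c * diff a i) (diff x j)"
  let ?K = "\<lambda>n i j. weight_sum p (min i j) * weight_tail n p (max i j)"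
  \<comment> \<open>The new row and column \<open>n\<close> may be included in the old sum, since the tail is empty there.\<close>
  have border: "?t (?K n i j) i j = 0" if "max i j = n" for i j
    using that by (simp add: weight_tail_def)
  have extend: "(\<Sum>i=1..<n. \<Sum>j=1..<n. ?t (?K n i j) i j) = (\<Sum>i=1..n. \<Sum>j=1..n. ?t (?K n i j) i j)"
    unfolding sum.cartesian_product
  proof (rule sum.mono_neutral_left)
    show "\<forall>z \<in> {1..n} \<times> {1..n} - {1..<n} \<times> {1..<n}. (case z of (i, j) \<Rightarrow> ?t (?K n i j) i j) = 0"
    proof
      fix z
      assume z: "z \<in> {1..n} \<times> {1..n} - {1..<n} \<times> {1..<n}"
      then have "max (fst z) (snd z) = n" by (cases z) auto
      then show "(case z of (i, j) \<Rightarrow> ?t (?K n i j) i j) = 0"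
        unfolding case_prod_unfold by (rule border)
    qed
  qed auto
  have "?t (?K (Suc n) i j) i j
      = ?t (?K n i j) i j + scale (of_real (p (Suc n))) (?t (weight_sum p (min i j)) i j)" for i j
    by (simp add: weight_tail_def weight_sum_Suc algebra_simps)
  then have "(\<Sum>i=1..<Suc n. \<Sum>j=1..<Suc n. ?t (?K (Suc n) i j) i j)
      = (\<Sum>i=1..n. \<Sum>j=1..n. ?t (?K n i j) i j)
        + scale (of_real (p (Suc n))) (\<Sum>i=1..n. \<Sum>j=1..n. ?t (weight_sum p (min i j)) i j)"
    by (simp only: atLeastLessThanSuc_atLeastAtMost sum.distrib scale_sum_right)
  then show ?case
    by (simp only: cebysev_Suc sum_weight_min_increments Suc.IH extend)
qed

section \<open>The three inequalities\<close>

lemma nrm_zero: "nrm 0 = 0"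
  by (simp add: nrm_eq_0_iff)

lemma nrm_nonneg: "0 \<le> nrm x"
proof -
  have "nrm (- x) = nrm x" using nrm_scale[of "- 1" x] by simp
  then show ?thesis using nrm_triangle[of x "- x"] by (simp add: nrm_zero)
qed

lemma nrm_sum_le: "nrm (sum f A) \<le> (\<Sum>i\<in>A. nrm (f i))"
proof (induction A rule: infinite_finite_induct)
  case (insert i A)
  then show ?case using nrm_triangle[of "f i" "sum f A"] by simp
qed (simp_all add: nrm_zero)

lemma nrm_cebysev_le:
  "nrm (cebysev scale n p a x)
     \<le> (\<Sum>i=1..n-1. \<Sum>j=1..n-1. kernel n p i j * (norm (diff a i) * nrm (diff x j)))"
proof -
  have range: "{1..<n} = {1..n-1}" by auto
  have "nrm (cebysev scale n p a x) \<le> (\<Sum>i=1..n-1. \<Sum>j=1..n-1. nrm (scale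
      (of_real (weight_sum p (min i j) * weight_tail n p (max i j)) * diff a i) (diff x j)))"
    unfolding cebysev_eq_sum_increments range
    by (rule order_trans[OF nrm_sum_le]) (intro sum_mono nrm_sum_le)
  then show ?thesis
    by (simp add: nrm_scale norm_mult kernel_def abs_mult mult_ac)
qed

end

lemma kernel_nonneg: "0 \<le> kernel n p i j"
  by (simp add: kernel_def)

lemma (in normed_space) nrm_cebysev_le_max_bound:
  "nrm (cebysev scale n p a x) \<le> max_bound nrm n p a x"
proof -
  let ?K = "{kernel n p i j | i j. i \<in> {1..n-1} \<and> j \<in> {1..n-1}}"
  have K: "?K = (\<lambda>(i, j). kernel n p i j) ` ({1..n-1} \<times> {1..n-1})" by force
  have "kernel n p i j \<le> Max ?K" if "i \<in> {1..n-1}" "j \<in> {1..n-1}" for i j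
  proof (rule Max_ge)
    show "finite ?K" unfolding K by simp
    show "kernel n p i j \<in> ?K" using that by blast
  qed
  then have "(\<Sum>i=1..n-1. \<Sum>j=1..n-1. kernel n p i j * (norm (diff a i) * nrm (diff x j)))
      \<le> (\<Sum>i=1..n-1. \<Sum>j=1..n-1. Max ?K * (norm (diff a i) * nrm (diff x j)))"
    by (intro sum_mono mult_right_mono) (auto simp: nrm_nonneg)
  also have "\<dots> = max_bound nrm n p a x"
    by (simp only: max_bound_def mult.assoc sum_product, simp only: sum_distrib_left)
  finally show ?thesis using nrm_cebysev_le[of n p a x] by linarith
qed

lemma (in normed_space) nrm_cebysev_le_sum_bound:
  "nrm (cebysev scale n p a x) \<le> sum_bound nrm n p a x"
proof -
  let ?A = "MAX i\<in>{1..n-1}. norm (diff a i)" and ?X = "MAX i\<in>{1..n-1}. nrm (diff x i)"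
  have A: "norm (diff a i) \<le> ?A" and X: "nrm (diff x i) \<le> ?X" if "i \<in> {1..n-1}" for i
    using that by (auto intro!: Max_ge)
  have "norm (diff a i) * nrm (diff x j) \<le> ?A * ?X"
    if "i \<in> {1..n-1}" "j \<in> {1..n-1}" for i j
    using A[OF that(1)] X[OF that(2)] order_trans[OF norm_ge_zero A[OF that(1)]]
    by (intro mult_mono) (auto simp: nrm_nonneg)
  then have "(\<Sum>i=1..n-1. \<Sum>j=1..n-1. kernel n p i j * (norm (diff a i) * nrm (diff x j)))
      \<le> (\<Sum>i=1..n-1. \<Sum>j=1..n-1. kernel n p i j * (?A * ?X))"
    by (intro sum_mono mult_left_mono) (auto simp: kernel_nonneg)
  also have "\<dots> = sum_bound nrm n p a x"
    by (simp only: sum_bound_def sum_distrib_right mult.assoc)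
  finally show ?thesis using nrm_cebysev_le[of n p a x] by linarith
qed

lemma conjugate_exponent_gt_1:
  fixes r s :: real
  assumes "r > 1" "1 / r + 1 / s = 1"
  shows "s > 1"
proof -
  have "0 < 1 / r" "1 / r < 1" using assms(1) by auto
  then have "0 < 1 / s" "1 / s < 1" using assms(2) by linarith+
  then show ?thesis by (simp add: field_simps)
qed

text \<open>
  The standard argument: when neither factor vanishes, Young's inequality for the normalized
  summands adds up to \<open>1 / s + 1 / r = 1\<close>.
\<close>

lemma Hoelder_inequality_sum:
  fixes f g :: "'i \<Rightarrow> real"
  assumes rs: "r > 1" "1 / r + 1 / s = 1"
    and f: "\<And>i. i \<in> I \<Longrightarrow> 0 \<le> f i" and g: "\<And>i. i \<in> I \<Longrightarrow> 0 \<le> g i"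
  shows "(\<Sum>i\<in>I. f i * g i)
    \<le> (\<Sum>i\<in>I. f i powr s) powr (1 / s) * (\<Sum>i\<in>I. g i powr r) powr (1 / r)"
proof -
  have "s > 1" using rs by (rule conjugate_exponent_gt_1)
  let ?F = "\<Sum>i\<in>I. f i powr s" and ?G = "\<Sum>i\<in>I. g i powr r"
  have nn: "?F \<ge> 0" "?G \<ge> 0" by (auto intro: sum_nonneg)
  show ?thesis
  proof (cases "finite I \<and> ?F > 0 \<and> ?G > 0")
    case False
    then consider "infinite I" | "finite I" "?F = 0" | "finite I" "?G = 0"
      using nn by linarith
    then have "(\<Sum>i\<in>I. f i * g i) = 0"
      by cases (auto simp: sum_nonneg_eq_0_iff intro!: sum.neutral)
    then show ?thesis by simp
  next
    case True
    let ?A = "?F powr (1 / s)" and ?B = "?G powr (1 / r)"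
    have pos: "?A > 0" "?B > 0" using True by simp_all
    have "f i * g i \<le> (?A * ?B) * (f i powr s / (s * ?F) + g i powr r / (r * ?G))"
      if "i \<in> I" for i
    proof -
      have "(f i / ?A) * (g i / ?B) \<le> (f i / ?A) powr s / s + (g i / ?B) powr r / r"
        using rs \<open>s > 1\<close> f[OF that] g[OF that] pos
        by (intro Youngs_inequality) (auto simp: add.commute)
      also have "\<dots> = f i powr s / (s * ?F) + g i powr r / (r * ?G)"
        using rs \<open>s > 1\<close> f[OF that] g[OF that] True
        by (simp add: powr_divide powr_powr mult.commute)
      finally show ?thesis using pos by (simp add: field_simps)
    qed
    then have "(\<Sum>i\<in>I. f i * g i)
        \<le> (\<Sum>i\<in>I. (?A * ?B) * (f i powr s / (s * ?F) + g i powr r / (r * ?G)))"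
      by (rule sum_mono)
    also have "\<dots> = (?A * ?B) * (?F / (s * ?F) + ?G / (r * ?G))"
      by (simp only: sum.distrib sum_distrib_left[symmetric] sum_divide_distrib)
    also have "\<dots> = ?A * ?B"
      using rs True by (simp add: add.commute)
    finally show ?thesis .
  qed
qed

lemma (in normed_space) nrm_cebysev_le_holder_bound:
  assumes rs: "r > 1" "1 / r + 1 / s = 1"
  shows "nrm (cebysev scale n p a x) \<le> holder_bound r s nrm n p a x"
proof -
  let ?I = "{1..n-1} \<times> {1..n-1}"
  let ?d = "\<lambda>(i, j). norm (diff a i) * nrm (diff x j)"
  have K: "(\<Sum>z\<in>?I. (case z of (i, j) \<Rightarrow> kernel n p i j) powr s) = (\<Sum>i=1..n-1. \<Sum>j=1..n-1.
      \<bar>weight_sum p (min i j)\<bar> powr s * \<bar>weight_tail n p (max i j)\<bar> powr s)"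
    unfolding sum.cartesian_product by (intro sum.cong) (auto simp: kernel_def powr_mult)
  have "(\<Sum>z\<in>?I. ?d z powr r)
      = (\<Sum>i=1..n-1. norm (diff a i) powr r) * (\<Sum>i=1..n-1. nrm (diff x i) powr r)"
    unfolding sum_product sum.cartesian_product
    by (intro sum.cong) (auto simp: powr_mult nrm_nonneg)
  then have D: "(\<Sum>z\<in>?I. ?d z powr r) powr (1 / r)
      = (\<Sum>i=1..n-1. norm (diff a i) powr r) powr (1 / r)
        * (\<Sum>i=1..n-1. nrm (diff x i) powr r) powr (1 / r)"
    by (simp add: powr_mult sum_nonneg)
  have "nrm (cebysev scale n p a x) \<le> (\<Sum>z\<in>?I. (case z of (i, j) \<Rightarrow> kernel n p i j) * ?d z)"
    using nrm_cebysev_le[of n p a x]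
    unfolding sum.cartesian_product by (simp add: case_prod_unfold)
  also have "\<dots> \<le> holder_bound r s nrm n p a x"
    using Hoelder_inequality_sum[OF rs, of ?I "\<lambda>(i, j). kernel n p i j" ?d]
    unfolding K D holder_bound_def
    by (simp add: case_prod_unfold kernel_nonneg nrm_nonneg mult.assoc)
  finally show ?thesis .
qed

section \<open>Sharpness\<close>

text \<open>
  One test case serves every bound: at these tuples the functional equals \<open>1\<close>, so a bound that also
  equals \<open>1\<close> there is attained.
\<close>

lemma sharpI:
  fixes R :: "('k::real_normed_field, 'k) bound"
  assumes "R norm 2 (\<lambda>_. 1) (\<lambda>i. if i = 2 then 1 else 0) (\<lambda>i. if i = 2 then 1 else 0) = 1"
  shows "sharp R"
  unfolding sharp_def
proof (intro allI impI)
  fix C :: real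
  let ?u = "\<lambda>i::nat. if i = 2 then 1 else 0 :: 'k"
  assume "\<forall>n\<ge>2. \<forall>(scale :: 'k \<Rightarrow> 'k \<Rightarrow> 'k) nrm. normed_space scale nrm \<longrightarrow>
      (\<forall>p a x. nrm (cebysev scale n p a x) \<le> C * R nrm n p a x)"
  then have "norm (cebysev (*) 2 (\<lambda>_. 1) ?u ?u) \<le> C * R norm 2 (\<lambda>_. 1) ?u ?u"
    using normed_space_mult by blast
  moreover have "cebysev (*) 2 (\<lambda>_. 1) ?u ?u = 1"
    by (simp add: cebysev_def weight_sum_def numeral_2_eq_2)
  ultimately show "C \<ge> 1" using assms by simp
qed

lemma sharp_max_bound: "sharp (max_bound :: ('k::real_normed_field, 'k) bound)"
  by (rule sharpI) (simp add: max_bound_def kernel_def weight_tail_def weight_sum_def diff_def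
      numeral_2_eq_2)

lemma sharp_holder_bound: "sharp (holder_bound r s :: ('k::real_normed_field, 'k) bound)"
  by (rule sharpI) (simp add: holder_bound_def weight_tail_def weight_sum_def diff_def
      numeral_2_eq_2)

lemma sharp_sum_bound: "sharp (sum_bound :: ('k::real_normed_field, 'k) bound)"
  by (rule sharpI) (simp add: sum_bound_def kernel_def weight_tail_def weight_sum_def diff_def
      numeral_2_eq_2)

section \<open>The theorem\<close>

theorem theorem7:
  fixes scale :: "'k::real_or_complex \<Rightarrow> 'x::ab_group_add \<Rightarrow> 'x"
    and nrm :: "'x \<Rightarrow> real"
    and n :: nat
    and p :: "nat \<Rightarrow> real"
    and a :: "nat \<Rightarrow> 'k"
    and x :: "nat \<Rightarrow> 'x"
  assumes "n \<ge> 2" and "normed_space scale nrm"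
  shows "nrm (cebysev scale n p a x) \<le> max_bound nrm n p a x
    \<and> (\<forall>r s. r > 1 \<and> 1 / r + 1 / s = 1 \<longrightarrow>
          nrm (cebysev scale n p a x) \<le> holder_bound r s nrm n p a x)
    \<and> nrm (cebysev scale n p a x) \<le> sum_bound nrm n p a x
    \<and> sharp (max_bound :: ('k, 'k) bound)
    \<and> (\<forall>r s. r > 1 \<and> 1 / r + 1 / s = 1 \<longrightarrow> sharp (holder_bound r s :: ('k, 'k) bound))
    \<and> sharp (sum_bound :: ('k, 'k) bound)"
proof -
  interpret normed_space scale nrm by fact
  show ?thesis
    using nrm_cebysev_le_max_bound nrm_cebysev_le_holder_bound nrm_cebysev_le_sum_bound
      sharp_max_bound sharp_holder_bound sharp_sum_bound
    by blast
qed

end
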